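(* Let $B=\{011,201\}$, and let $A(x,v)$ and $B(x,v,u)$ be the generating functions defined in the context. The generating function $\sum_{n\geq 0}|I_n(011,201)|\,x^{n+1}$ is equal to $A(x,0)$, and it satisfies $$A(x,0)=\frac{x}{1-2x}+\frac{x^2}{(1-x)^2}\,B\!\left(x,\frac{x}{1-x},1\right).$$
   Context: For $n\ge 0$, $I_n$ denotes the set of inversion sequences $e=e_0e_1\cdots e_n$, i.e. integer sequences with $0\le e_i\le i$ for each $0\le i\le n$. An inversion sequence contains a pattern $\tau$ if it has a (not necessarily consecutive) subsequence order isomorphic to $\tau$ (including equalities); otherwise it avoids $\tau$. $I_n(\tau_1,\dots,\tau_m)$ (also written $I_n(B)$ for $B=\{\tau_1,\dots,\tau_m\}$) is the set of $e\in I_n$ avoiding all $\tau_i$. $\mathcal T(B)$ is the rooted plane tree with root $0$ whose level-$n$ nodes are the elements of $I_n(B)$ (root at level 0), where the parent of $e_0\cdots e_n$ is $e_0\cdots e_{n-1}$ and siblings are ordered left to right by increasing last letter. For a node $e$, $\mathcal T(B;e)$ is the subtree consisting of $e$ and its descendants. The generating function for the number of nodes in $\mathcal T(B;e)$ is the power series in which a node at distance $\ell\ge 0$ below the root $e$ contributes $x^{\ell+1}$. Here $0^m$ is the word of $m$ zeros and $0^mj$ is $0^m$ followed by the letter $j$. Let $A_m(x)$ (for $m\ge1$) and $B_{m,j}(x)$ (for $2\le j\le m$) be the generating functions for the number of nodes in $\mathcal T(B;0^m)$ and $\mathcal T(B;0^mj)$ respectively, and set $$A(x,v)=\sum_{m\ge1}A_m(x)v^{m-1},\qquad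 B(x,v,u)=\sum_{m\ge2}\sum_{j=2}^m B_{m,j}(x)\,v^{m-2}u^{m-j}.$$ *)

theory Defs
  imports
    "HOL-Computational_Algebra.Computational_Algebra"
    "HOL-Library.Sublist"
begin

definition inversion_seqs :: "nat \<Rightarrow> nat list set" where
  "inversion_seqs n = {e. length e = Suc n \<and> (\<forall>i\<le>n. e ! i \<le> i)}"

text \<open>Requiring \<open><\<close> to be reflected for all ordered pairs of positions also forces equal
  letters to correspond to equal letters.\<close>

definition order_isomorphic :: "nat list \<Rightarrow> nat list \<Rightarrow> bool" where
  "order_isomorphic s t \<longleftrightarrow> length s = length t \<and>
     (\<forall>i<length t. \<forall>j<length t. s ! i < s ! j \<longleftrightarrow> t ! i < t ! j)"

definition contains_pattern :: "nat list \<Rightarrow> nat list \<Rightarrow> bool" where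
  "contains_pattern e \<tau> \<longleftrightarrow> (\<exists>s. subseq s e \<and> order_isomorphic s \<tau>)"

definition avoiding_inversion_seqs :: "nat \<Rightarrow> nat list set \<Rightarrow> nat list set" where
  "avoiding_inversion_seqs n B =
     {e \<in> inversion_seqs n. \<forall>\<tau>\<in>B. \<not> contains_pattern e \<tau>}"

text \<open>The tree \<open>\<T>(B)\<close> is given by its nodes and its parent relation.  The left-to-right order of
  siblings does not affect the number of nodes on each level and is not recorded.\<close>

definition tree_nodes :: "nat list set \<Rightarrow> nat list set" where
  "tree_nodes B = (\<Union>n. avoiding_inversion_seqs n B)"

definition tree_edges :: "nat list set \<Rightarrow> (nat list \<times> nat list) set" where
  "tree_edges B = {(e, f). e \<in> tree_nodes B \<and> f \<in> tree_nodes B \<and> e = butlast f}"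

definition subtree_level :: "nat list set \<Rightarrow> nat list \<Rightarrow> nat \<Rightarrow> nat list set" where
  "subtree_level B e l = {f \<in> tree_nodes B. (e, f) \<in> tree_edges B ^^ l}"

definition subtree_gf :: "nat list set \<Rightarrow> nat list \<Rightarrow> rat fps" where
  "subtree_gf B e = fps_X * Abs_fps (\<lambda>l. of_nat (card (subtree_level B e l)))"

definition A_coeff :: "nat list set \<Rightarrow> nat \<Rightarrow> rat fps" where
  "A_coeff B m = subtree_gf B (replicate m 0)"

definition B_coeff :: "nat list set \<Rightarrow> nat \<Rightarrow> nat \<Rightarrow> rat fps" where
  "B_coeff B m j = subtree_gf B (replicate m 0 @ [j])"

text \<open>Multivariate series are iterated: the outermost variable is \<open>v\<close>, the innermost is \<open>x\<close>.
  For a fixed power of \<open>v\<close> only finitely many powers of \<open>u\<close> occur in \<open>B(x,v,u)\<close>, so its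
  coefficients are polynomials in \<open>u\<close> and \<open>u\<close> may be specialised to 1.
  The indices are shifted by \<open>m = k + 1\<close> and \<open>m = k + 2\<close>, respectively.\<close>

definition A_gf :: "nat list set \<Rightarrow> rat fps fps" where
  "A_gf B = Abs_fps (\<lambda>k. A_coeff B (k + 1))"

definition B_gf :: "nat list set \<Rightarrow> rat fps poly fps" where
  "B_gf B = Abs_fps (\<lambda>k. \<Sum>j = 2..k + 2. monom (B_coeff B (k + 2) j) (k + 2 - j))"

definition eval_u :: "'a::comm_semiring_0 poly fps \<Rightarrow> 'a \<Rightarrow> 'a fps" where
  "eval_u F c = Abs_fps (\<lambda>k. poly (fps_nth F k) c)"

text \<open>Substitution of a series \<open>g(x)\<close> for \<open>v\<close> in \<open>F(x,v)\<close>, as a sum in the topology of formal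
  power series; it converges if \<open>g(0) = 0\<close>.  (This is not \<open>fps_compose\<close>, in which \<open>g\<close>
  would have to be a series in \<open>v\<close>.)\<close>

definition subst_v :: "'a::comm_ring_1 fps fps \<Rightarrow> 'a fps \<Rightarrow> 'a fps" where
  "subst_v F g = (\<Sum>k. fps_nth F k * g ^ k)"

lemma subst_v_sums:
  fixes F :: "'a::comm_ring_1 fps fps" and g :: "'a fps"
  assumes "fps_nth g 0 = 0"
  shows "(\<lambda>k. fps_nth F k * g ^ k) sums
           Abs_fps (\<lambda>n. \<Sum>k\<le>n. fps_nth (fps_nth F k * g ^ k) n)"
  unfolding sums_def
proof (rule tendsto_fpsI)
  fix n
  have z: "fps_nth (fps_nth F k * g ^ k) n = 0" if "n < k" for k
    using that startsby_zero_power_prefix[OF assms, of k]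
    by (simp add: fps_mult_nth)
  have "fps_nth (\<Sum>k<N. fps_nth F k * g ^ k) n
      = fps_nth (Abs_fps (\<lambda>n. \<Sum>k\<le>n. fps_nth (fps_nth F k * g ^ k) n)) n" if "n < N" for N
    unfolding fps_sum_nth fps_nth_Abs_fps
    by (rule sum.mono_neutral_right) (use that z in auto)
  then show "\<forall>\<^sub>F N in sequentially. fps_nth (\<Sum>k<N. fps_nth F k * g ^ k) n
      = fps_nth (Abs_fps (\<lambda>n. \<Sum>k\<le>n. fps_nth (fps_nth F k * g ^ k) n)) n"
    unfolding eventually_sequentially by (meson Suc_le_lessD)
qed

end

theory Submission
  imports Defs
begin

text \<open>
  In the tree for \<open>{011, 201}\<close> the node \<open>0\<^sup>m\<close> has the children \<open>0\<^sup>m\<^sup>+\<^sup>1\<close> and \<open>0\<^sup>mj\<close> with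
  \<open>1 \<le> j \<le> m\<close>.  The subtree at \<open>0\<^sup>m1\<close> is isomorphic to the one at \<open>0\<^sup>m\<close>: the letter 1 cannot
  occur again, since \<open>0\<close>, \<open>1\<close>, \<open>1\<close> would be an occurrence of \<open>011\<close>, and it takes part in no
  occurrence of \<open>201\<close>, since all letters before it are 0.  So this letter may be deleted and all
  later positive letters (which are at least 2) lowered by one; the later letters also move one
  position to the left, so that the bounds \<open>e\<^sub>i \<le> i\<close> persist
  (\<open>node_insert_one_iff\<close>, \<open>num_ext_insert_one\<close>).

  With \<open>S\<^sub>m = (\<Sum>j=2..m. B\<^sub>m\<^sub>,\<^sub>j)\<close>, counting nodes by the first step below \<open>0\<^sup>m\<close> gives
  \<open>A\<^sub>m = x (1 + A\<^sub>m\<^sub>+\<^sub>1 + A\<^sub>m + S\<^sub>m)\<close>, that is, \<open>A\<^sub>m = t (1 + A\<^sub>m\<^sub>+\<^sub>1 + S\<^sub>m)\<close> where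
  \<open>t = x / (1 - x)\<close>.  The constant \<open>c = x / (1 - 2x)\<close> solves \<open>c = t (1 + c)\<close>, so the differences
  \<open>A\<^sub>m - c\<close> satisfy \<open>A\<^sub>m - c = t (A\<^sub>m\<^sub>+\<^sub>1 - c + S\<^sub>m)\<close>.  Since \<open>S\<^sub>1 = 0\<close>, iterating this from
  \<open>m = 1\<close> yields \<open>A\<^sub>1 - c = t\<^sup>2 (\<Sum>k. S\<^sub>k\<^sub>+\<^sub>2 t\<^sup>k)\<close>, which is the claim.
\<close>

section \<open>Subtrees as sets of extensions\<close>

lemma tree_nodes_iff:
  "e \<in> tree_nodes B \<longleftrightarrow>
     e \<noteq> [] \<and> (\<forall>i<length e. e ! i \<le> i) \<and> (\<forall>\<tau>\<in>B. \<not> contains_pattern e \<tau>)"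
  by (cases e)
     (auto simp: tree_nodes_def avoiding_inversion_seqs_def inversion_seqs_def less_Suc_eq_le)

lemma contains_pattern_append: "contains_pattern e \<tau> \<Longrightarrow> contains_pattern (e @ w) \<tau>"
  unfolding contains_pattern_def by (meson subseq_append_iff subseq_order.trans list_emb_append2 prefix_imp_subseq prefixI)

lemma tree_nodes_prefix:
  assumes "e @ w \<in> tree_nodes B" "e \<noteq> []"
  shows "e \<in> tree_nodes B"
proof -
  have "e ! i \<le> i" if "i < length e" for i
  proof -
    have "(e @ w) ! i \<le> i"
      using assms(1) that by (simp add: tree_nodes_iff)
    with that show ?thesis by (simp add: nth_append)
  qed
  then show ?thesis
    using assms contains_pattern_append by (auto simp: tree_nodes_iff)
qed

text \<open>The level \<open>l\<close> below \<open>e\<close> consists of the nodes that extend \<open>e\<close> by \<open>l\<close> letters.  The empty word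
  is excluded because it is not a node, although it is a prefix of every node.\<close>

lemma subtree_level_eq:
  assumes "e \<noteq> []"
  shows "subtree_level B e l = (@) e ` {w. length w = l \<and> e @ w \<in> tree_nodes B}"
proof (induction l)
  case 0
  show ?case by (auto simp: subtree_level_def)
next
  case (Suc l)
  show ?case
  proof (intro equalityI subsetI)
    fix f assume "f \<in> subtree_level B e (Suc l)"
    then obtain g where f: "f \<in> tree_nodes B" and g: "(e, g) \<in> tree_edges B ^^ l"
        and gf: "(g, f) \<in> tree_edges B"
      by (auto simp: subtree_level_def)
    have "g \<in> subtree_level B e l"
      using g gf by (auto simp: subtree_level_def tree_edges_def)
    then obtain w where w: "length w = l" "g = e @ w"
      using Suc.IH by auto
    have "f \<noteq> []" using f by (simp add: tree_nodes_iff)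
    then have "f = g @ [last f]"
      using gf by (simp add: tree_edges_def)
    then have "f = e @ (w @ [last f])" using w by simp
    with w f show "f \<in> (@) e ` {w. length w = Suc l \<and> e @ w \<in> tree_nodes B}"
      by (intro image_eqI[of _ _ "w @ [last f]"]) auto
  next
    fix f assume "f \<in> (@) e ` {w. length w = Suc l \<and> e @ w \<in> tree_nodes B}"
    then obtain w where w: "length w = Suc l" "f = e @ w" "f \<in> tree_nodes B" by auto
    define v where "v = butlast w"
    have wv: "w = v @ [last w]" "length v = l"
      using w(1) by (auto simp: v_def intro!: append_butlast_last_id[symmetric])
    have node: "e @ v \<in> tree_nodes B"
      using tree_nodes_prefix[of "e @ v" "[last w]" B] w wv assms by simp
    then have "e @ v \<in> subtree_level B e l"
      using Suc.IH wv by auto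
    moreover have "(e @ v, f) \<in> tree_edges B"
      using node w(2,3) wv(1) by (simp add: tree_edges_def) (metis append_assoc butlast_snoc)
    ultimately show "f \<in> subtree_level B e (Suc l)"
      using w(3) by (auto simp: subtree_level_def)
  qed
qed

text \<open>The words that extend \<open>e\<close> to a node \<open>l\<close> levels below it, and their number.\<close>

definition exts :: "nat list set \<Rightarrow> nat list \<Rightarrow> nat \<Rightarrow> nat list set" where
  "exts B e l = {w. length w = l \<and> e @ w \<in> tree_nodes B}"

definition num_ext :: "nat list set \<Rightarrow> nat list \<Rightarrow> nat \<Rightarrow> nat" where
  "num_ext B e l = card (exts B e l)"

lemma card_subtree_level: "e \<noteq> [] \<Longrightarrow> card (subtree_level B e l) = num_ext B e l"
  by (simp add: subtree_level_eq num_ext_def exts_def card_image inj_on_def)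

lemma subtree_gf_eq:
  "e \<noteq> [] \<Longrightarrow> subtree_gf B e = fps_X * Abs_fps (\<lambda>l. of_nat (num_ext B e l))"
  by (simp add: subtree_gf_def card_subtree_level)

lemma finite_exts: "finite (exts B e l)"
proof (rule finite_subset)
  show "exts B e l \<subseteq> {w. set w \<subseteq> {..length e + l} \<and> length w = l}"
  proof (clarsimp simp: exts_def)
    fix w x assume w: "e @ w \<in> tree_nodes B" and "x \<in> set w"
    then obtain i where i: "i < length w" "w ! i = x" by (auto simp: in_set_conv_nth)
    have "(e @ w) ! (length e + i) \<le> length e + i"
      using w i(1) unfolding tree_nodes_iff by (metis length_append nat_add_left_cancel_less)
    with i show "x \<le> length e + length w" by simp
  qed
qed (simp add: finite_lists_length_eq)

lemma num_ext_Suc: "num_ext B e (Suc l) = (\<Sum>j\<le>length e. num_ext B (e @ [j]) l)"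
proof -
  have "exts B e (Suc l) = (\<Union>j\<le>length e. (#) j ` exts B (e @ [j]) l)"
  proof (intro equalityI subsetI)
    fix w assume w: "w \<in> exts B e (Suc l)"
    then obtain j v where jv: "w = j # v" "length v = l"
      by (auto simp: exts_def length_Suc_conv)
    have "(e @ w) ! length e \<le> length e"
      using w jv(1) by (simp add: exts_def tree_nodes_iff del: nth_append_length)
    with w jv show "w \<in> (\<Union>j\<le>length e. (#) j ` exts B (e @ [j]) l)"
      by (auto simp: exts_def)
  qed (auto simp: exts_def)
  also have "card \<dots> = (\<Sum>j\<le>length e. card ((#) j ` exts B (e @ [j]) l))"
    by (rule card_UN_disjoint) (auto simp: finite_exts)
  finally show ?thesis
    by (simp add: num_ext_def card_image)
qed

lemma avoiding_inversion_seqs_card: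
  "card (avoiding_inversion_seqs n B) = num_ext B [0] n"
proof -
  have "avoiding_inversion_seqs n B = (#) 0 ` exts B [0] n"
  proof (intro equalityI subsetI)
    fix e assume e: "e \<in> avoiding_inversion_seqs n B"
    then obtain x w where xw: "e = x # w" "length w = n"
      by (auto simp: avoiding_inversion_seqs_def inversion_seqs_def length_Suc_conv)
    have "e ! 0 \<le> 0"
      using e unfolding avoiding_inversion_seqs_def inversion_seqs_def by blast
    with xw e show "e \<in> (#) 0 ` exts B [0] n"
      by (auto simp: exts_def tree_nodes_def)
  qed (auto simp: exts_def tree_nodes_iff avoiding_inversion_seqs_def inversion_seqs_def
        less_Suc_eq_le)
  then show ?thesis by (simp add: num_ext_def card_image)
qed

section \<open>The patterns 011 and 201\<close>

lemma contains_011_iff: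
  "contains_pattern e [0, 1, 1] \<longleftrightarrow> (\<exists>a b. a < b \<and> subseq [a, b, b] e)"
proof
  assume "contains_pattern e [0, 1, 1]"
  then obtain s where s: "subseq s e" "order_isomorphic s [0, 1, 1]"
    by (auto simp: contains_pattern_def)
  then obtain a b c where "s = [a, b, c]"
    by (auto simp: order_isomorphic_def length_Suc_conv)
  with s show "\<exists>a b. a < b \<and> subseq [a, b, b] e"
    by (intro exI[of _ a] exI[of _ b])
       (auto simp: order_isomorphic_def All_less_Suc2 numeral_3_eq_3)
next
  assume "\<exists>a b. a < b \<and> subseq [a, b, b] e"
  then obtain a b where "a < b" "subseq [a, b, b] e" by blast
  then show "contains_pattern e [0, 1, 1]"
    unfolding contains_pattern_def
    by (intro exI[of _ "[a, b, b]"]) (simp add: order_isomorphic_def All_less_Suc2 numeral_3_eq_3)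
qed

lemma contains_201_iff:
  "contains_pattern e [2, 0, 1] \<longleftrightarrow> (\<exists>a b c. a < b \<and> b < c \<and> subseq [c, a, b] e)"
proof
  assume "contains_pattern e [2, 0, 1]"
  then obtain s where s: "subseq s e" "order_isomorphic s [2, 0, 1]"
    by (auto simp: contains_pattern_def)
  then obtain c a b where "s = [c, a, b]"
    by (auto simp: order_isomorphic_def length_Suc_conv)
  with s show "\<exists>a b c. a < b \<and> b < c \<and> subseq [c, a, b] e"
    by (intro exI[of _ a] exI[of _ b] exI[of _ c])
       (auto simp: order_isomorphic_def All_less_Suc2 numeral_3_eq_3)
next
  assume "\<exists>a b c. a < b \<and> b < c \<and> subseq [c, a, b] e"
  then obtain a b c where "a < b" "b < c" "subseq [c, a, b] e" by blast
  then show "contains_pattern e [2, 0, 1]"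
    unfolding contains_pattern_def
    by (intro exI[of _ "[c, a, b]"]) (simp add: order_isomorphic_def All_less_Suc2 numeral_3_eq_3)
qed

lemma subseq_replicate_append_neq:
  "x \<noteq> y \<Longrightarrow> subseq (x # xs) (replicate m y @ w) \<longleftrightarrow> subseq (x # xs) w"
  by (induction m) auto

text \<open>A leading 0 plays the 0 of \<open>011\<close>, so avoiding \<open>011\<close> means that no positive letter is
  repeated.\<close>

lemma zeros_append_node_iff:
  assumes "1 \<le> m"
  shows "replicate m 0 @ w \<in> tree_nodes {[0, 1, 1], [2, 0, 1]} \<longleftrightarrow>
    (\<forall>i<length w. w ! i \<le> m + i) \<and> \<not> (\<exists>b>0. subseq [b, b] w) \<and>
    \<not> (\<exists>a b c. a < b \<and> b < c \<and> subseq [c, a, b] w)"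
proof -
  let ?e = "replicate m 0 @ w"
  have bounds: "(\<forall>i<length ?e. ?e ! i \<le> i) \<longleftrightarrow> (\<forall>i<length w. w ! i \<le> m + i)"
  proof (intro iffI allI impI)
    fix i assume "\<forall>i<length ?e. ?e ! i \<le> i" "i < length w"
    then have "?e ! (m + i) \<le> m + i" by simp
    then show "w ! i \<le> m + i" by (simp add: nth_append)
  next
    fix i assume *: "\<forall>i<length w. w ! i \<le> m + i" "i < length ?e"
    then show "?e ! i \<le> i"
      using *(1)[rule_format, of "i - m"] by (cases "i < m") (auto simp: nth_append)
  qed
  have p011: "contains_pattern ?e [0, 1, 1] \<longleftrightarrow> (\<exists>b>0. subseq [b, b] w)"
    unfolding contains_011_iff
  proof (intro iffI; elim exE conjE)
    fix a b assume "a < b" "subseq [a, b, b] ?e"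
    then have "subseq [b, b] ?e" by (auto dest: subseq_Cons')
    with \<open>a < b\<close> have "subseq [b, b] w"
      using subseq_replicate_append_neq[of b 0 "[b]" m w] by simp
    moreover have "0 < b" using \<open>a < b\<close> by simp
    ultimately show "\<exists>b>0. subseq [b, b] w" by blast
  next
    fix b assume "0 < b" "subseq [b, b] w"
    moreover have "?e = 0 # (replicate (m - 1) 0 @ w)"
      using assms by (cases m) auto
    ultimately have "subseq [0, b, b] ?e"
      by (simp add: list_emb_append2)
    with \<open>0 < b\<close> show "\<exists>a b. a < b \<and> subseq [a, b, b] ?e" by blast
  qed
  have p201: "contains_pattern ?e [2, 0, 1] \<longleftrightarrow>
      (\<exists>a b c. a < b \<and> b < c \<and> subseq [c, a, b] w)"
    unfolding contains_201_iff
    by (metis subseq_replicate_append_neq less_nat_zero_code)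
  have "?e \<noteq> []" using assms by auto
  then show ?thesis
    unfolding tree_nodes_iff bounds ball_simps(5,7) p011 p201 by blast
qed

text \<open>The increasing bijection from the natural numbers onto those different from 1.\<close>

definition skip_one :: "nat \<Rightarrow> nat" where
  "skip_one k = (if k = 0 then 0 else Suc k)"

lemma skip_one_less_iff: "skip_one a < skip_one b \<longleftrightarrow> a < b"
  by (auto simp: skip_one_def)

lemma skip_one_simps [simp]:
  "skip_one a = skip_one b \<longleftrightarrow> a = b" "skip_one a \<noteq> Suc 0" "Suc 0 \<noteq> skip_one a" "0 < skip_one a \<longleftrightarrow> 0 < a"
  by (auto simp: skip_one_def)

lemma skip_one_surj: "b \<noteq> 1 \<Longrightarrow> \<exists>a. b = skip_one a"
  by (rule exI[of _ "b - 1"]) (auto simp: skip_one_def)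

lemma subseq_mapE:
  assumes "subseq xs (map f ys)"
  obtains zs where "xs = map f zs" "subseq zs ys"
  using assms by (metis subseq_conv_nths nths_map)

lemma subseq_map_skip_one_iff: "subseq (map skip_one xs) (map skip_one ys) \<longleftrightarrow> subseq xs ys"
proof
  assume "subseq (map skip_one xs) (map skip_one ys)"
  then obtain zs where "map skip_one xs = map skip_one zs" "subseq zs ys"
    by (rule subseq_mapE)
  moreover have "inj skip_one" by (simp add: inj_def)
  ultimately show "subseq xs ys" by (simp add: inj_map_eq_map)
qed (rule subseq_map)

text \<open>Inserting the letter 1 after the initial zeros and skipping it in the later letters preserves
  and reflects being a node.\<close>

lemma node_insert_one_iff:
  assumes "1 \<le> m"
  shows "replicate m 0 @ 1 # map skip_one w \<in> tree_nodes {[0, 1, 1], [2, 0, 1]} \<longleftrightarrow>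
    replicate m 0 @ w \<in> tree_nodes {[0, 1, 1], [2, 0, 1]}"
proof -
  let ?w = "map skip_one w"
  have bounds: "(\<forall>i<length (1 # ?w). (1 # ?w) ! i \<le> m + i) \<longleftrightarrow> (\<forall>i<length w. w ! i \<le> m + i)"
  proof -
    have "skip_one k \<le> Suc (m + i) \<longleftrightarrow> k \<le> m + i" for k i
      by (auto simp: skip_one_def)
    with assms show ?thesis by (simp add: All_less_Suc2)
  qed
  have repeated: "(\<exists>b>0. subseq [b, b] (1 # ?w)) \<longleftrightarrow> (\<exists>b>0. subseq [b, b] w)"
  proof (intro iffI; elim exE conjE)
    fix b :: nat assume b: "0 < b" "subseq [b, b] (1 # ?w)"
    have "b \<noteq> 1"
    proof
      assume "b = 1"
      then have "1 \<in> set ?w" using b(2) by (simp add: subseq_singleton_left)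
      then show False by auto
    qed
    then have "subseq [b, b] ?w" using b(2) by simp
    then obtain zs where "[b, b] = map skip_one zs" "subseq zs w"
      by (rule subseq_mapE)
    then obtain a where "b = skip_one a" "subseq [a, a] w"
      by (auto simp: Cons_eq_map_conv)
    with b(1) show "\<exists>b>0. subseq [b, b] w" by auto
  next
    fix b :: nat assume "0 < b" "subseq [b, b] w"
    then have "subseq [skip_one b, skip_one b] (1 # ?w)"
      using subseq_map_skip_one_iff[of "[b, b]" w] by auto
    with \<open>0 < b\<close> show "\<exists>b>0. subseq [b, b] (1 # ?w)"
      by (intro exI[of _ "skip_one b"]) auto
  qed
  have occ_201: "(\<exists>a b c. a < b \<and> b < c \<and> subseq [c, a, b] (1 # ?w)) \<longleftrightarrow>
      (\<exists>a b c. a < b \<and> b < c \<and> subseq [c, a, b] w)"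
  proof (intro iffI; elim exE conjE)
    fix a b c :: nat assume *: "a < b" "b < c" "subseq [c, a, b] (1 # ?w)"
    then have "subseq [c, a, b] ?w" by auto
    then obtain zs where "[c, a, b] = map skip_one zs" "subseq zs w"
      by (rule subseq_mapE)
    then obtain a' b' c' where "a = skip_one a'" "b = skip_one b'" "c = skip_one c'"
        "subseq [c', a', b'] w"
      by (auto simp: Cons_eq_map_conv)
    with * show "\<exists>a b c. a < b \<and> b < c \<and> subseq [c, a, b] w"
      by (auto simp: skip_one_less_iff)
  next
    fix a b c :: nat assume *: "a < b" "b < c" "subseq [c, a, b] w"
    then have "subseq [skip_one c, skip_one a, skip_one b] (1 # ?w)"
      using subseq_map_skip_one_iff[of "[c, a, b]" w] by auto
    with * show "\<exists>a b c. a < b \<and> b < c \<and> subseq [c, a, b] (1 # ?w)"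
      using skip_one_less_iff by blast
  qed
  show ?thesis
    unfolding zeros_append_node_iff[OF assms] bounds repeated occ_201 by (rule refl)
qed

text \<open>The subtrees at \<open>0\<^sup>m1\<close> and at \<open>0\<^sup>m\<close> have the same number of nodes on each level.\<close>

lemma num_ext_insert_one:
  assumes "1 \<le> m"
  shows "num_ext {[0, 1, 1], [2, 0, 1]} (replicate m 0 @ [1]) l =
    num_ext {[0, 1, 1], [2, 0, 1]} (replicate m 0) l"
proof -
  let ?B = "{[0, 1, 1], [2, 0, 1]} :: nat list set"
  have "exts ?B (replicate m 0 @ [1]) l = map skip_one ` exts ?B (replicate m 0) l"
  proof (intro equalityI subsetI)
    fix w assume w: "w \<in> exts ?B (replicate m 0 @ [1]) l"
    then have node: "replicate m 0 @ 1 # w \<in> tree_nodes ?B" and len: "length w = l"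
      by (auto simp: exts_def)
    have "\<forall>b>0. \<not> subseq [b, b] (1 # w)"
      using node unfolding zeros_append_node_iff[OF assms] by blast
    then have "\<not> subseq [1, 1] (1 # w)" by (rule allE[of _ 1]) simp
    then have "1 \<notin> set w" by (simp add: subseq_singleton_left)
    then have "\<forall>x\<in>set w. \<exists>a. x = skip_one a" using skip_one_surj by metis
    then obtain v where v: "w = map skip_one v" using ex_map_conv[of w skip_one] by metis
    with node len show "w \<in> map skip_one ` exts ?B (replicate m 0) l"
      using node_insert_one_iff[OF assms, of v] by (auto simp: exts_def)
  next
    fix w assume "w \<in> map skip_one ` exts ?B (replicate m 0) l"
    then show "w \<in> exts ?B (replicate m 0 @ [1]) l"
      using node_insert_one_iff[OF assms] by (auto simp: exts_def)
  qed
  moreover have "inj skip_one" by (simp add: inj_def)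
  ultimately show ?thesis
    by (simp add: num_ext_def card_image inj_on_subset[OF inj_mapI])
qed

section \<open>The functional equation\<close>

lemma num_ext_zeros_0:
  assumes "1 \<le> m"
  shows "num_ext {[0, 1, 1], [2, 0, 1]} (replicate m 0) 0 = 1"
proof -
  have "replicate m 0 \<in> tree_nodes {[0, 1, 1], [2, 0, 1]}"
    using zeros_append_node_iff[OF assms, of "[]"] by simp
  then have "exts {[0, 1, 1], [2, 0, 1]} (replicate m 0) 0 = {[]}"
    by (auto simp: exts_def)
  then show ?thesis by (simp add: num_ext_def)
qed

lemma num_ext_zeros_Suc:
  assumes "1 \<le> m"
  shows "num_ext {[0, 1, 1], [2, 0, 1]} (replicate m 0) (Suc l) =
    num_ext {[0, 1, 1], [2, 0, 1]} (replicate (m + 1) 0) l +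
    num_ext {[0, 1, 1], [2, 0, 1]} (replicate m 0) l +
    (\<Sum>j=2..m. num_ext {[0, 1, 1], [2, 0, 1]} (replicate m 0 @ [j]) l)"
proof -
  have "{..m} = insert 0 (insert 1 {2..m})" using assms by auto
  then show ?thesis
    by (simp add: num_ext_Suc num_ext_insert_one[OF assms, simplified]
        replicate_append_same flip: replicate_Suc)
qed

text \<open>The summand \<open>A\<^sub>m\<close> on the right-hand side counts the subtree at \<open>0\<^sup>m1\<close>.\<close>

lemma A_coeff_rec:
  fixes B :: "nat list set"
  defines "B \<equiv> {[0, 1, 1], [2, 0, 1]}"
  assumes "1 \<le> m"
  shows "A_coeff B m =
    fps_X * (1 + A_coeff B (m + 1) + A_coeff B m + (\<Sum>j=2..m. B_coeff B m j))"
proof -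
  have A: "A_coeff B k = fps_X * Abs_fps (\<lambda>l. of_nat (num_ext B (replicate k 0) l))"
    if "1 \<le> k" for k
    unfolding A_coeff_def by (rule subtree_gf_eq) (use that in auto)
  have S: "(\<Sum>j=2..m. B_coeff B m j) =
      fps_X * Abs_fps (\<lambda>l. of_nat (\<Sum>j=2..m. num_ext B (replicate m 0 @ [j]) l))"
    by (rule fps_ext) (simp add: B_coeff_def subtree_gf_eq fps_sum_nth)
  have "Abs_fps (\<lambda>l. of_nat (num_ext B (replicate m 0) l)) =
      1 + A_coeff B (m + 1) + A_coeff B m + (\<Sum>j=2..m. B_coeff B m j)"
  proof (rule fps_ext)
    fix n
    show "Abs_fps (\<lambda>l. of_nat (num_ext B (replicate m 0) l)) $ n =
      (1 + A_coeff B (m + 1) + A_coeff B m + (\<Sum>j=2..m. B_coeff B m j)) $ n"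
      unfolding S A[OF assms(2)] A[of "m + 1", OF le_add2]
      using num_ext_zeros_0[OF assms(2)] num_ext_zeros_Suc[OF assms(2)]
      by (cases n) (simp_all add: B_def)
  qed
  then show ?thesis using A[OF assms(2)] by simp
qed

section \<open>Solving by iteration\<close>

lemma tendsto_diff_power_mult_fps:
  fixes t :: "'a::comm_ring_1 fps"
  assumes "t $ 0 = 0"
  shows "(\<lambda>k. a - t ^ k * C k) \<longlonglongrightarrow> a"
proof (rule tendsto_fpsI)
  fix n
  have "(a - t ^ k * C k) $ n = a $ n" if "n < k" for k
    using that startsby_zero_power_prefix[OF assms, of k] by (simp add: fps_mult_nth)
  then show "\<forall>\<^sub>F k in sequentially. (a - t ^ k * C k) $ n = a $ n"
    unfolding eventually_sequentially by (meson Suc_le_lessD)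
qed

text \<open>A recurrence \<open>C\<^sub>k = F\<^sub>k + t C\<^sub>k\<^sub>+\<^sub>1\<close> with \<open>t(0) = 0\<close> is solved by \<open>C\<^sub>0 = (\<Sum>k. F\<^sub>k t\<^sup>k)\<close>.\<close>

lemma subst_v_eqI:
  fixes t :: "'a::comm_ring_1 fps"
  assumes "t $ 0 = 0" and C: "\<And>k. C k = F $ k + t * C (Suc k)"
  shows "subst_v F t = C 0"
proof -
  have "(\<Sum>k<N. F $ k * t ^ k) = C 0 - t ^ N * C N" for N
  proof (induction N)
    case (Suc N)
    show ?case
      using Suc.IH C[of N] by (simp add: algebra_simps)
  qed simp
  then have "(\<lambda>k. F $ k * t ^ k) sums C 0"
    unfolding sums_def using tendsto_diff_power_mult_fps[OF assms(1)] by simp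
  then show ?thesis
    unfolding subst_v_def by (simp add: sums_iff)
qed

lemma subst_v_0: "subst_v F (0 :: 'a::comm_ring_1 fps) = F $ 0"
  by (rule subst_v_eqI[where C = "\<lambda>k. F $ k"]) simp_all

lemma eval_u_B_gf_nth: "eval_u (B_gf B) 1 $ k = (\<Sum>j=2..k+2. B_coeff B (k + 2) j)"
  by (simp add: eval_u_def B_gf_def poly_sum poly_monom)

theorem theorem4p11:
  fixes B :: "nat list set"
  defines "B \<equiv> {[0, 1, 1], [2, 0, 1]}"
  shows "fps_X * Abs_fps (\<lambda>n. of_nat (card (avoiding_inversion_seqs n B))) = subst_v (A_gf B) 0
       \<and> subst_v (A_gf B) 0
           = fps_X / (1 - 2 * fps_X)
             + fps_X ^ 2 / (1 - fps_X) ^ 2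
               * subst_v (eval_u (B_gf B) 1) (fps_X / (1 - fps_X))"
proof
  have A1: "subst_v (A_gf B) 0 = A_coeff B 1"
    by (simp add: subst_v_0 A_gf_def)
  show "fps_X * Abs_fps (\<lambda>n. of_nat (card (avoiding_inversion_seqs n B))) = subst_v (A_gf B) 0"
    unfolding A1 by (simp add: A_coeff_def subtree_gf_eq avoiding_inversion_seqs_card)

  define t :: "rat fps" where "t = fps_X / (1 - fps_X)"
  define c :: "rat fps" where "c = fps_X / (1 - 2 * fps_X)"
  define S where "S m = (\<Sum>j=2..m. B_coeff B m j)" for m
  define D where "D m = A_coeff B m - c" for m
  have u1: "is_unit (1 - fps_X :: rat fps)" and u2: "is_unit (1 - 2 * fps_X :: rat fps)"
    by (simp_all add: fps_is_unit_iff)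
  have t: "(1 - fps_X) * t = fps_X" and c: "(1 - 2 * fps_X) * c = fps_X"
    using u1 u2 by (simp_all add: t_def c_def unit_imp_dvd)
  have t0: "t $ 0 = 0"
    using arg_cong[OF t, of "\<lambda>f. f $ 0"] by simp
  have D: "D m = t * (D (m + 1) + S m)" if "1 \<le> m" for m
  proof -
    have "(1 - fps_X) * A_coeff B m = fps_X * (1 + A_coeff B (m + 1) + S m)"
      using A_coeff_rec[OF that] unfolding S_def B_def by (simp add: algebra_simps)
    moreover have "(1 - fps_X) * c = fps_X * (1 + c)"
      using c by (simp add: algebra_simps)
    ultimately have "(1 - fps_X) * D m = fps_X * (1 + A_coeff B (m + 1) + S m) - fps_X * (1 + c)"
      by (simp only: D_def right_diff_distrib[of "1 - fps_X"])
    also have "\<dots> = fps_X * (D (m + 1) + S m)"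
      by (simp add: D_def algebra_simps)
    also have "\<dots> = (1 - fps_X) * (t * (D (m + 1) + S m))"
      by (metis t mult.assoc)
    finally show ?thesis using u1 by auto
  qed
  have "D (k + 3) + S (k + 2) = eval_u (B_gf B) 1 $ k + t * (D (Suc k + 3) + S (Suc k + 2))" for k
  proof -
    have "D (k + 3) = t * (D (k + 3 + 1) + S (k + 3))"
      by (rule D) simp
    moreover have "eval_u (B_gf B) 1 $ k = S (k + 2)"
      by (simp add: eval_u_B_gf_nth S_def)
    moreover have "k + 3 + 1 = Suc k + 3" "k + 3 = Suc k + 2" by simp_all
    ultimately show ?thesis by (metis add.commute)
  qed
  \<comment> \<open>The factor \<open>t\<close> is not invertible, so the series is summed through the cofactors
    \<open>D\<^sub>k\<^sub>+\<^sub>3 + S\<^sub>k\<^sub>+\<^sub>2\<close> of \<open>t\<close> in \<open>D\<^sub>k\<^sub>+\<^sub>2\<close>.\<close>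
  from subst_v_eqI[where C = "\<lambda>k. D (k + 3) + S (k + 2)", OF t0 this]
  have "subst_v (eval_u (B_gf B) 1) t = D 3 + S 2" by (simp add: numeral_2_eq_2)
  moreover have "D 1 = t * D 2"
    using D[of 1] by (simp add: S_def numeral_2_eq_2)
  moreover have "D 2 = t * (D 3 + S 2)"
    using D[of 2] by simp
  ultimately have "D 1 = t ^ 2 * subst_v (eval_u (B_gf B) 1) t"
    by (simp only: power2_eq_square mult.assoc)
  moreover have "A_coeff B 1 = c + D 1"
    by (simp add: D_def)
  moreover have "t ^ 2 = fps_X ^ 2 / (1 - fps_X) ^ 2"
    using u1 by (simp add: t_def div_power unit_imp_dvd)
  ultimately show "subst_v (A_gf B) 0 = fps_X / (1 - 2 * fps_X)
      + fps_X ^ 2 / (1 - fps_X) ^ 2 * subst_v (eval_u (B_gf B) 1) (fps_X / (1 - fps_X))"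
    unfolding A1 c_def[symmetric] t_def[symmetric] by (simp only:)
qed

end
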